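(* Let $N\ge 2$ and $K\ge 1$ be integers, let $\alpha_k,\beta_k,\delta_k>0$ for $k=1,\dots,K$, and let $x(t)=(x_1(t),\dots,x_N(t))$, $t\ge 0$, be the inhomogeneous symmetric simple exclusion process with open boundaries on $G=\{0,1,\dots,K\}^N$ with these rates. Then the Markov chain $x(t)$ is ergodic: for every state $(x_1,\dots,x_N)\in G$ the steady probability $p(x_1,\dots,x_N)=\lim_{t\to\infty}P\big(x(t)=(x_1,\dots,x_N)\mid x(0)=y\big)$ exists, does not depend on the initial state $y\in G$, and is not equal to zero.
   Context: The process: $x(t)=(x_1(t),\dots,x_N(t))$ is a continuous-time Markov chain with finite state space $G=\{0,1,\dots,K\}^N$. Sites are numbered $1,\dots,N$ from left to right; $x_i=0$ means that site $i$ is vacant, and $x_i=k\in\{1,\dots,K\}$ means that site $i$ is occupied by a particle of type $k$. The transitions and their rates are, for each $k=1,\dots,K$: (arrival) for $i=1$ and for $i=N$, if $x_i=0$, then $x_i$ changes to $k$ at rate $\alpha_k$ (a particle of type $k$ enters from outside); (departure) for $i=1$ and for $i=N$, if $x_i=k$, then $x_i$ changes to $0$ at rate $\beta_k$ (the particle leaves the system); (hop) for any two adjacent sites $i,j\in\{1,\dots,N\}$, $|i-j|=1$, if $x_i=k$ and $x_j=0$, then the particle in site $i$ moves to site $j$ (so $x_i$ becomes $0$ and $x_j$ becomes $k$) at rate $\delta_k$. No other transitions occur. *)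

theory Defs
  imports "HOL-Probability.Probability"
begin

text \<open>
  A time-homogeneous continuous-time Markov chain on a finite state space \<open>S\<close> is a family of laws
  \<open>M y\<close>, one for each initial state \<open>y \<in> S\<close>, together with random variables \<open>X t\<close>, \<open>t \<ge> 0\<close>.
  The Markov property is stated on elementary past events, so that only conditioning on events of
  positive probability occurs. The transition rates \<open>q w z\<close> are used for \<open>w \<noteq> z\<close> only;
  since \<open>S\<close> is finite, they determine the behaviour of the probability of remaining in \<open>w\<close>.
  No regularity of the paths is required.
\<close>

locale finite_ctmc =
  fixes S :: "'s set"
    and q :: "'s \<Rightarrow> 's \<Rightarrow> real"
    and M :: "'s \<Rightarrow> 'a measure"
    and X :: "real \<Rightarrow> 'a \<Rightarrow> 's"
  assumes finite_states: "finite S"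
    and prob_space_law: "y \<in> S \<Longrightarrow> prob_space (M y)"
    and measurable_state: "y \<in> S \<Longrightarrow> 0 \<le> t \<Longrightarrow> X t \<in> measurable (M y) (count_space S)"
    and initial_state: "y \<in> S \<Longrightarrow> \<P>(\<omega> in M y. X 0 \<omega> = y) = 1"
    and markov_property:
      "y \<in> S \<Longrightarrow> w \<in> S \<Longrightarrow> z \<in> S \<Longrightarrow> 0 \<le> s \<Longrightarrow> 0 \<le> t \<Longrightarrow> finite J \<Longrightarrow> J \<subseteq> {0..<s} \<Longrightarrow>
       0 < \<P>(\<omega> in M y. X s \<omega> = w \<and> (\<forall>r\<in>J. X r \<omega> = c r)) \<Longrightarrow>
       \<P>(\<omega> in M y. X (s + t) \<omega> = z \<bar> X s \<omega> = w \<and> (\<forall>r\<in>J. X r \<omega> = c r))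
         = \<P>(\<omega> in M w. X t \<omega> = z)"
    and transition_rate:
      "w \<in> S \<Longrightarrow> z \<in> S \<Longrightarrow> w \<noteq> z \<Longrightarrow>
       ((\<lambda>h. \<P>(\<omega> in M w. X h \<omega> = z) / h) \<longlongrightarrow> q w z) (at_right 0)"

definition exclusion_states :: "nat \<Rightarrow> nat \<Rightarrow> (nat \<Rightarrow> nat) set" where
  "exclusion_states N K = {1..N} \<rightarrow>\<^sub>E {0..K}"

text \<open>
  The rate from \<open>x\<close> to \<open>z\<close> adds up the rates of all arrivals, departures and hops that turn
  \<open>x\<close> into \<open>z\<close>.
\<close>

definition exclusion_rate ::
  "nat \<Rightarrow> nat \<Rightarrow> (nat \<Rightarrow> real) \<Rightarrow> (nat \<Rightarrow> real) \<Rightarrow> (nat \<Rightarrow> real) \<Rightarrow> (nat \<Rightarrow> nat) \<Rightarrow> (nat \<Rightarrow> nat) \<Rightarrow> real"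
where
  "exclusion_rate N K \<alpha> \<beta> \<delta> x z =
     (\<Sum>k=1..K.
        (\<Sum>i\<in>{1, N}. if x i = 0 \<and> z = x(i := k) then \<alpha> k else 0)
      + (\<Sum>i\<in>{1, N}. if x i = k \<and> z = x(i := 0) then \<beta> k else 0)
      + (\<Sum>i=1..N. \<Sum>j=1..N.
           if \<bar>int i - int j\<bar> = 1 \<and> x i = k \<and> x j = 0 \<and> z = x(i := 0, j := k) then \<delta> k else 0))"

end

(* Write P for the transition function of the chain. For small h > 0 every diagonal entry of P h,
   and every entry with a positive rate, is positive; as the exclusion process is irreducible, some
   power P (n h) = P T has all entries at least a > 0. By Doeblin's argument the oscillation of
   P t y x in the initial state y shrinks by the factor 1 - a over each period of length T, while
   its minimum over y increases with t, so P t y x tends to a limit p x >= a independent of y.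
   Irreducibility holds because all transitions are reversible and every configuration can be
   emptied by repeatedly moving the leftmost particle out through site 1. *)

theory Submission
  imports Defs
begin

section \<open>Convergence of irreducible finite chains\<close>

context finite_ctmc
begin

section \<open>Transition function and Chapman-Kolmogorov equation\<close>

definition transition :: "real \<Rightarrow> 's \<Rightarrow> 's \<Rightarrow> real" where
  "transition t y z = \<P>(\<omega> in M y. X t \<omega> = z)"

text \<open>The directed graph of jumps. Loops are left out because \<open>transition_rate\<close>
  gives a meaning to \<open>q w z\<close> for \<open>w \<noteq> z\<close> only.\<close>

definition rate_graph :: "('s \<times> 's) set" where
  "rate_graph = {(w, z). w \<in> S \<and> z \<in> S \<and> w \<noteq> z \<and> 0 < q w z}"

lemma state_event:
  assumes "y \<in> S" "0 \<le> t"
  shows "{\<omega> \<in> space (M y). X t \<omega> = z} \<in> sets (M y)"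
proof -
  have "X t -` ({z} \<inter> S) \<inter> space (M y) \<in> sets (M y)"
    using measurable_state[OF assms] by (rule measurable_sets) simp
  also have "X t -` ({z} \<inter> S) \<inter> space (M y) = {\<omega> \<in> space (M y). X t \<omega> = z}"
    using measurable_space[OF measurable_state[OF assms]] by auto
  finally show ?thesis .
qed

lemma transition_nonneg: "0 \<le> transition t y z"
  by (simp add: transition_def)

text \<open>Law of total probability for the state at time \<open>s\<close>. With \<open>Q\<close>
  trivial it gives the row sums of the transition matrix; with \<open>Q\<close> an event at a later
  time it gives the Chapman-Kolmogorov equation.\<close>

lemma sum_over_states:
  assumes y: "y \<in> S" "0 \<le> s" and A: "{\<omega> \<in> space (M y). Q \<omega>} \<in> sets (M y)"
  shows "\<P>(\<omega> in M y. Q \<omega>) = (\<Sum>w\<in>S. \<P>(\<omega> in M y. Q \<omega> \<and> X s \<omega> = w))"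
proof -
  interpret prob_space "M y" by (rule prob_space_law[OF y(1)])
  have ev: "{\<omega> \<in> space (M y). Q \<omega> \<and> X s \<omega> = w} \<in> sets (M y)" for w
    using sets.sets_Collect_conj[OF state_event[OF y] A] by simp
  have "{\<omega> \<in> space (M y). Q \<omega>} = (\<Union>w\<in>S. {\<omega> \<in> space (M y). Q \<omega> \<and> X s \<omega> = w})"
    using measurable_space[OF measurable_state[OF y]] by auto
  moreover have "prob (\<Union>w\<in>S. {\<omega> \<in> space (M y). Q \<omega> \<and> X s \<omega> = w})
      = (\<Sum>w\<in>S. \<P>(\<omega> in M y. Q \<omega> \<and> X s \<omega> = w))"
    by (rule finite_measure_finite_Union[OF finite_states])
       (use ev in \<open>auto simp: disjoint_family_on_def\<close>)
  ultimately show ?thesis by simp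
qed

lemma transition_sum:
  assumes "y \<in> S" "0 \<le> t"
  shows "(\<Sum>z\<in>S. transition t y z) = 1"
proof -
  interpret prob_space "M y" by (rule prob_space_law[OF assms(1)])
  show ?thesis
    using sum_over_states[OF assms, of "\<lambda>_. True"] prob_space by (simp add: transition_def)
qed

lemma transition_le_1:
  assumes "y \<in> S"
  shows "transition t y z \<le> 1"
proof -
  interpret prob_space "M y" by (rule prob_space_law[OF assms(1)])
  show ?thesis by (simp add: transition_def)
qed

lemma chapman_kolmogorov:
  assumes y: "y \<in> S" and z: "z \<in> S" and st: "0 \<le> s" "0 \<le> t"
  shows "transition (s + t) y z = (\<Sum>w\<in>S. transition s y w * transition t w z)"
proof -
  interpret prob_space "M y" by (rule prob_space_law[OF y])
  have "\<P>(\<omega> in M y. X (s + t) \<omega> = z \<and> X s \<omega> = w) = transition s y w * transition t w z"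
    if w: "w \<in> S" for w
  \<comment> \<open>The Markov property speaks only of conditioning events of positive probability,
    so an intermediate state of probability zero is treated apart; there both sides vanish.\<close>
  proof (cases "transition s y w = 0")
    case True
    have "\<P>(\<omega> in M y. X (s + t) \<omega> = z \<and> X s \<omega> = w) \<le> transition s y w"
      unfolding transition_def
      by (rule finite_measure_mono) (use state_event[OF y st(1)] in auto)
    with True show ?thesis by (simp add: measure_le_0_iff)
  next
    case False
    then have "0 < transition s y w" using transition_nonneg[of s y w] by simp
    then show ?thesis
      \<comment> \<open>With \<open>J\<close> empty only the present state is conditioned on, and
        the past values \<open>c\<close> are arbitrary.\<close>
      using markov_property[OF y w z st, of "{}" undefined]
      by (simp add: transition_def cond_prob_def field_simps)
  qed
  then show ?thesis
    using sum_over_states[OF y st(1) state_event[OF y, of "s + t" z]] st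
    by (simp add: transition_def)
qed

section \<open>Positivity of transition probabilities\<close>

lemma transition_pos_trans:
  assumes "y \<in> S" "w \<in> S" "z \<in> S" "0 \<le> s" "0 \<le> t" "0 < transition s y w" "0 < transition t w z"
  shows "0 < transition (s + t) y z"
  unfolding chapman_kolmogorov[OF assms(1,3,4,5)]
  by (rule sum_pos2[OF finite_states assms(2)])
     (use assms in \<open>auto simp: transition_nonneg\<close>)

lemma eventually_transition_pos:
  assumes "w \<in> S" "z \<in> S" "w \<noteq> z" "0 < q w z"
  shows "\<forall>\<^sub>F h in at_right 0. 0 < transition h w z"
proof -
  have "\<forall>\<^sub>F h in at_right 0. 0 < transition h w z / h"
    using order_tendstoD(1)[OF transition_rate[OF assms(1-3)] assms(4)]
    by (simp add: transition_def)
  with eventually_at_right_less[of "0::real"] show ?thesis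
    by eventually_elim (simp add: zero_less_divide_iff)
qed

text \<open>Since \<open>transition h w z / h\<close> has a finite limit, the probability of being
  in any other state \<open>z\<close> tends to 0 with \<open>h\<close>. Finitely many such terms sum
  to less than 1 for small \<open>h\<close>, and the rest of the row sum lies on the
  diagonal.\<close>

lemma eventually_transition_refl_pos:
  assumes w: "w \<in> S"
  shows "\<forall>\<^sub>F h in at_right 0. 0 < transition h w w"
proof -
  have "((\<lambda>h. transition h w z) \<longlongrightarrow> 0) (at_right 0)" if "z \<in> S - {w}" for z
  proof -
    have "((\<lambda>h. transition h w z / h * h) \<longlongrightarrow> q w z * 0) (at_right 0)"
      using that transition_rate[OF w, of z] unfolding transition_def
      by (intro tendsto_mult) (auto intro: tendsto_ident_at)
    moreover have "\<forall>\<^sub>F h in at_right 0. transition h w z / h * h = transition h w z"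
      using eventually_at_right_less[of "0::real"] by eventually_elim simp
    ultimately show ?thesis using tendsto_cong by fastforce
  qed
  then have "((\<lambda>h. \<Sum>z\<in>S - {w}. transition h w z) \<longlongrightarrow> (\<Sum>z\<in>S - {w}. 0)) (at_right 0)"
    by (intro tendsto_sum)
  then have "\<forall>\<^sub>F h in at_right 0. (\<Sum>z\<in>S - {w}. transition h w z) < 1"
    by (rule order_tendstoD(2)) simp
  with eventually_at_right_less[of "0::real"] show ?thesis
  proof eventually_elim
    case (elim h)
    then show ?case
      using transition_sum[OF w, of h] sum.remove[OF finite_states w, of "transition h w"] by simp
  qed
qed

text \<open>One small step \<open>h\<close> serves all states and all edges at once, as both are
  finite in number. A path with \<open>n\<close> edges then gives positivity at time
  \<open>n * h\<close>, and positive diagonal entries allow all paths to be padded to a common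
  length.\<close>

lemma ex_all_transitions_pos:
  assumes irreducible: "\<And>y z. y \<in> S \<Longrightarrow> z \<in> S \<Longrightarrow> (y, z) \<in> rate_graph\<^sup>*"
  obtains T where "0 < T" "\<And>y z. y \<in> S \<Longrightarrow> z \<in> S \<Longrightarrow> 0 < transition T y z"
proof -
  have "\<forall>\<^sub>F h in at_right 0. 0 < h \<and> (\<forall>y\<in>S. 0 < transition h y y) \<and>
      (\<forall>e\<in>rate_graph. 0 < transition h (fst e) (snd e))"
  proof (intro eventually_conj eventually_ball_finite ballI finite_states
      eventually_transition_refl_pos)
    show "\<forall>\<^sub>F h::real in at_right 0. 0 < h" by (rule eventually_at_right_less)
    show "finite rate_graph"
      by (rule finite_subset[of _ "S \<times> S"]) (auto simp: rate_graph_def finite_states)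
    show "\<forall>\<^sub>F h in at_right 0. 0 < transition h (fst e) (snd e)" if "e \<in> rate_graph" for e
      using that by (auto simp: rate_graph_def intro: eventually_transition_pos)
  qed auto
  then obtain h where h: "0 < h" and refl: "\<And>y. y \<in> S \<Longrightarrow> 0 < transition h y y"
    and edge: "\<And>w z. (w, z) \<in> rate_graph \<Longrightarrow> 0 < transition h w z"
    by (force dest: eventually_happens)
  have extend: "0 < transition (real (Suc n) * h) y z"
    if "0 < transition (real n * h) y w" "0 < transition h w z" "y \<in> S" "w \<in> S" "z \<in> S"
    for n y w z
    using transition_pos_trans[OF that(3-5) _ _ that(1,2)] h by (simp add: algebra_simps)
  have reach: "z \<in> S \<and> (\<exists>n. 0 < transition (real n * h) y z)"
    if "(y, z) \<in> rate_graph\<^sup>*" "y \<in> S" for y z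
    using that
  proof (induction rule: rtrancl_induct)
    case base
    then have "0 < transition (real 1 * h) y y" using refl by simp
    with base show ?case by blast
  next
    case (step w z)
    then show ?case
      using extend edge[of w z] unfolding rate_graph_def by blast
  qed
  have later: "0 < transition (real m * h) y z"
    if "n \<le> m" "0 < transition (real n * h) y z" "y \<in> S" "z \<in> S" for n m y z
    using that
  proof (induction rule: dec_induct)
    case (step k)
    show ?case
      by (rule extend[OF step.IH[OF step.prems] refl]) (fact step.prems)+
  qed
  have "\<forall>e\<in>S \<times> S. \<exists>n. 0 < transition (real n * h) (fst e) (snd e)"
    using reach[OF irreducible] by (simp add: mem_Times_iff)
  then obtain n where n: "\<forall>e\<in>S \<times> S. 0 < transition (real (n e) * h) (fst e) (snd e)"
    using bchoice[of "S \<times> S" "\<lambda>e n. 0 < transition (real n * h) (fst e) (snd e)"] by blast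
  \<comment> \<open>The maximum dominates all path lengths; the successor keeps \<open>m\<close>,
    and hence the time \<open>m * h\<close>, positive even if all these lengths are 0.\<close>
  define m where "m = Suc (Max (n ` (S \<times> S)))"
  show thesis
  proof
    show "0 < real m * h" using h by (simp add: m_def)
    show "0 < transition (real m * h) y z" if "y \<in> S" "z \<in> S" for y z
    proof (rule later[OF _ _ that])
      show "0 < transition (real (n (y, z)) * h) y z"
        using bspec[OF n, of "(y, z)"] that by simp
      have "n (y, z) \<le> Max (n ` (S \<times> S))"
        using that finite_states by (intro Max_ge) auto
      then show "n (y, z) \<le> m" by (simp add: m_def)
    qed
  qed
qed

section \<open>Doeblin contraction of the oscillation in the initial state\<close>

definition upper :: "'s \<Rightarrow> real \<Rightarrow> real" where
  "upper x t = Max ((\<lambda>y. transition t y x) ` S)"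

definition lower :: "'s \<Rightarrow> real \<Rightarrow> real" where
  "lower x t = Min ((\<lambda>y. transition t y x) ` S)"

lemma transition_le_upper: "y \<in> S \<Longrightarrow> transition t y x \<le> upper x t"
  unfolding upper_def using finite_states by (intro Max_ge) auto

lemma lower_le_transition: "y \<in> S \<Longrightarrow> lower x t \<le> transition t y x"
  unfolding lower_def using finite_states by (intro Min_le) auto

lemma lower_attained:
  assumes "x \<in> S"
  obtains w where "w \<in> S" "transition t w x = lower x t"
proof -
  have "lower x t \<in> (\<lambda>y. transition t y x) ` S"
    unfolding lower_def using assms finite_states by (intro Min_in) auto
  then show thesis using that by auto
qed

lemma upper_attained:
  assumes "x \<in> S"
  obtains w where "w \<in> S" "transition t w x = upper x t"
proof -
  have "upper x t \<in> (\<lambda>y. transition t y x) ` S"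
    unfolding upper_def using assms finite_states by (intro Max_in) auto
  then show thesis using that by auto
qed

text \<open>By Chapman-Kolmogorov, a value at time \<open>t\<close> is an average of values at time
  \<open>s\<close> with weights \<open>transition (t - s) y w\<close>, so it cannot fall below their
  minimum.\<close>

lemma lower_mono:
  assumes x: "x \<in> S" and "0 \<le> s" "s \<le> t"
  shows "lower x s \<le> lower x t"
proof -
  obtain y where y: "y \<in> S" "transition t y x = lower x t" using lower_attained[OF x] .
  have "lower x s = (\<Sum>w\<in>S. transition (t - s) y w * lower x s)"
    using transition_sum[OF y(1), of "t - s"] assms by (simp flip: sum_distrib_right)
  also have "\<dots> \<le> (\<Sum>w\<in>S. transition (t - s) y w * transition s w x)"
    by (intro sum_mono mult_left_mono lower_le_transition transition_nonneg)
  also have "\<dots> = lower x t"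
    using chapman_kolmogorov[OF y(1) x, of "t - s" s] assms y by simp
  finally show ?thesis .
qed

text \<open>The gap below \<open>upper x s\<close> after a further time \<open>t\<close> is an
  average of nonnegative gaps. Keeping only the term of a state \<open>v\<close> where the minimum
  is attained, whose weight is at least \<open>a\<close>, bounds it from below.\<close>

lemma upper_decrease:
  assumes x: "x \<in> S" and st: "0 \<le> s" "0 \<le> t"
    and a: "\<And>y z. y \<in> S \<Longrightarrow> z \<in> S \<Longrightarrow> a \<le> transition t y z"
  shows "upper x (t + s) \<le> upper x s - a * (upper x s - lower x s)"
proof -
  obtain y where y: "y \<in> S" "transition (t + s) y x = upper x (t + s)"
    using upper_attained[OF x] .
  obtain v where v: "v \<in> S" "transition s v x = lower x s" using lower_attained[OF x] .
  have "(\<Sum>w\<in>S. transition t y w * (upper x s - transition s w x))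
      = upper x s - upper x (t + s)"
    using chapman_kolmogorov[OF y(1) x st(2,1)] y transition_sum[OF y(1) st(2)]
    by (simp add: right_diff_distrib sum_subtractf flip: sum_distrib_right)
  moreover have "transition t y v * (upper x s - transition s v x)
      \<le> (\<Sum>w\<in>S. transition t y w * (upper x s - transition s w x))"
    using finite_states transition_le_upper transition_nonneg v
    by (intro member_le_sum) auto
  moreover have "a * (upper x s - lower x s) \<le> transition t y v * (upper x s - transition s v x)"
    using a[OF y(1) v(1)] transition_le_upper[OF v(1), of s x] v by (auto intro: mult_right_mono)
  ultimately show ?thesis by linarith
qed

lemma upper_antimono:
  assumes "x \<in> S" "0 \<le> s" "s \<le> t"
  shows "upper x t \<le> upper x s"
  using upper_decrease[OF assms(1,2), of "t - s" 0] assms transition_nonneg by simp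

theorem irreducible_ergodic:
  assumes irreducible: "\<And>y z. y \<in> S \<Longrightarrow> z \<in> S \<Longrightarrow> (y, z) \<in> rate_graph\<^sup>*" and x: "x \<in> S"
  obtains p where "0 < p" "\<And>y. y \<in> S \<Longrightarrow> ((\<lambda>t. transition t y x) \<longlongrightarrow> p) at_top"
proof -
  obtain T where T: "0 < T" and pos: "\<And>y z. y \<in> S \<Longrightarrow> z \<in> S \<Longrightarrow> 0 < transition T y z"
    using ex_all_transitions_pos[OF irreducible] by metis
  \<comment> \<open>The Doeblin constant: the least of finitely many positive entries.\<close>
  define a where "a = Min ((\<lambda>(y, z). transition T y z) ` (S \<times> S))"
  have a_le: "a \<le> transition T y z" if "y \<in> S" "z \<in> S" for y z
    unfolding a_def using that finite_states by (intro Min_le) (auto intro!: image_eqI[of _ _ "(y, z)"])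
  have a_pos: "0 < a"
    unfolding a_def using x finite_states pos by (subst Min_gr_iff) auto
  have a_le_1: "a \<le> 1" using a_le[OF x x] transition_le_1[OF x] order_trans by blast
  have bounds: "lower x t \<le> upper x t" for t
    using lower_le_transition[OF x] transition_le_upper[OF x] order_trans by blast
  \<comment> \<open>Over one period the maximum drops by at least \<open>a\<close> times the
    oscillation while the minimum does not drop. Initially the oscillation is at most 1.\<close>
  have decay: "upper x (real n * T) - lower x (real n * T) \<le> (1 - a) ^ n" for n
  proof (induction n)
    case 0
    have "upper x 0 \<le> 1" using upper_attained[OF x] transition_le_1 by metis
    moreover have "0 \<le> lower x 0" using lower_attained[OF x] transition_nonneg by metis
    ultimately show ?case by simp
  next
    case (Suc n)
    have "upper x (T + real n * T) - lower x (T + real n * T)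
        \<le> (1 - a) * (upper x (real n * T) - lower x (real n * T))"
      using upper_decrease[OF x, of "real n * T" T a] lower_mono[OF x, of "real n * T" "T + real n * T"]
        T a_le by (simp add: algebra_simps)
    also have "\<dots> \<le> (1 - a) * (1 - a) ^ n"
      using Suc a_le_1 by (intro mult_left_mono) auto
    finally show ?case by (simp add: algebra_simps)
  qed
  \<comment> \<open>The limit is the supremum of the increasing minima. Comparing at time
    \<open>max s t\<close> puts every minimum below every maximum, so \<open>p\<close> lies between
    \<open>lower x t\<close> and \<open>upper x t\<close> at every time
    \<open>t \<ge> 0\<close>.\<close>
  define p where "p = Sup (lower x ` {0..})"
  have lower_le_upper: "lower x s \<le> upper x t" if "0 \<le> s" "0 \<le> t" for s t
    using lower_mono[OF x that(1), of "max s t"] bounds[of "max s t"]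
      upper_antimono[OF x that(2), of "max s t"] by simp
  have lower_le_p: "lower x t \<le> p" if "0 \<le> t" for t
    unfolding p_def using that lower_le_upper[of _ 0]
    by (intro cSup_upper) (auto intro!: bdd_aboveI2[where M = "upper x 0"])
  have p_le_upper: "p \<le> upper x t" if "0 \<le> t" for t
    unfolding p_def using that lower_le_upper by (intro cSup_least) auto
  show thesis
  proof
    have "a \<le> lower x T" using lower_attained[OF x] a_le x by metis
    with a_pos lower_le_p[of T] T show "0 < p" by simp
    show "((\<lambda>t. transition t y x) \<longlongrightarrow> p) at_top" if y: "y \<in> S" for y
    proof (rule tendstoI)
      fix e :: real assume "0 < e"
      then obtain n where n: "(1 - a) ^ n < e"
        using real_arch_pow_inv[of e "1 - a"] a_pos by auto
      show "\<forall>\<^sub>F t in at_top. dist (transition t y x) p < e"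
        \<comment> \<open>From this time on, both \<open>p\<close> and the transition probability
          lie in an interval of length below \<open>e\<close>, by monotonicity of its
          endpoints.\<close>
        using eventually_ge_at_top[of "real n * T"]
      proof eventually_elim
        case (elim t)
        have nT: "0 \<le> real n * T" using T by simp
        then have "0 \<le> t" using elim by linarith
        then show ?case
          using decay[of n] n lower_mono[OF x nT elim] upper_antimono[OF x nT elim]
            lower_le_p[of t] p_le_upper[of t]
            lower_le_transition[OF y, of x t] transition_le_upper[OF y, of t x]
          by (simp add: dist_real_def)
      qed
    qed
  qed
qed

text \<open>The conditioning event has probability 1 under \<open>M y\<close>, so conditioning
  changes nothing.\<close>

lemma cond_prob_initial:
  assumes y: "y \<in> S" and t: "0 \<le> t"
  shows "\<P>(\<omega> in M y. X t \<omega> = x \<bar> X 0 \<omega> = y) = transition t y x"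
proof -
  interpret prob_space "M y" by (rule prob_space_law[OF y])
  have "AE \<omega> in M y. X 0 \<omega> = y"
    using initial_state[OF y] state_event[OF y order_refl, of y] by (simp add: prob_Collect_eq_1)
  then have "\<P>(\<omega> in M y. X t \<omega> = x \<and> X 0 \<omega> = y) = \<P>(\<omega> in M y. X t \<omega> = x)"
    using state_event[OF y t, of x] state_event[OF y order_refl, of y]
    by (intro finite_measure_eq_AE) (auto intro: sets.sets_Collect_conj)
  then show ?thesis by (simp add: cond_prob_def initial_state[OF y] transition_def)
qed

end

section \<open>Irreducibility of the exclusion process\<close>

text \<open>Rates are required to be positive in both directions, which makes the relation
  symmetric: a path to the empty configuration can be run backwards.\<close>

definition exclusion_link ::
  "nat \<Rightarrow> nat \<Rightarrow> (nat \<Rightarrow> real) \<Rightarrow> (nat \<Rightarrow> real) \<Rightarrow> (nat \<Rightarrow> real) \<Rightarrow> ((nat \<Rightarrow> nat) \<times> (nat \<Rightarrow> nat)) set"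
where
  "exclusion_link N K \<alpha> \<beta> \<delta> = {(x, z). x \<in> exclusion_states N K \<and> z \<in> exclusion_states N K \<and>
     x \<noteq> z \<and> 0 < exclusion_rate N K \<alpha> \<beta> \<delta> x z \<and> 0 < exclusion_rate N K \<alpha> \<beta> \<delta> z x}"

section \<open>Positive rates of single moves\<close>

context
  fixes N K :: nat and \<alpha> \<beta> \<delta> :: "nat \<Rightarrow> real"
  assumes \<alpha>_pos: "\<And>k. k \<in> {1..K} \<Longrightarrow> 0 < \<alpha> k"
    and \<beta>_pos: "\<And>k. k \<in> {1..K} \<Longrightarrow> 0 < \<beta> k"
    and \<delta>_pos: "\<And>k. k \<in> {1..K} \<Longrightarrow> 0 < \<delta> k"
begin

text \<open>All summands of the rate are nonnegative, so one positive group of moves of a single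
  type makes the total positive.\<close>

lemma exclusion_rate_pos_if:
  assumes k: "k \<in> {1..K}"
    and "0 < (\<Sum>i\<in>{1, N}. if x i = 0 \<and> z = x(i := k) then \<alpha> k else 0)
      \<or> 0 < (\<Sum>i\<in>{1, N}. if x i = k \<and> z = x(i := 0) then \<beta> k else 0)
      \<or> 0 < (\<Sum>i=1..N. \<Sum>j=1..N.
           if \<bar>int i - int j\<bar> = 1 \<and> x i = k \<and> x j = 0 \<and> z = x(i := 0, j := k) then \<delta> k else 0)"
  shows "0 < exclusion_rate N K \<alpha> \<beta> \<delta> x z"
proof -
  have nonneg: "0 \<le> (\<Sum>i\<in>{1, N}. if x i = 0 \<and> z = x(i := k) then \<alpha> k else 0)"
    "0 \<le> (\<Sum>i\<in>{1, N}. if x i = k \<and> z = x(i := 0) then \<beta> k else 0)"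
    "0 \<le> (\<Sum>i=1..N. \<Sum>j=1..N.
           if \<bar>int i - int j\<bar> = 1 \<and> x i = k \<and> x j = 0 \<and> z = x(i := 0, j := k) then \<delta> k else 0)"
    if "k \<in> {1..K}" for k
    using \<alpha>_pos[OF that] \<beta>_pos[OF that] \<delta>_pos[OF that] by (intro sum_nonneg; simp)+
  show ?thesis
    unfolding exclusion_rate_def
  proof (rule sum_pos2[OF _ k], goal_cases)
    case 2
    then show ?case using assms(2) nonneg[OF k] by linarith
  next
    case (3 k)
    then show ?case using nonneg[OF 3] by linarith
  qed simp
qed

lemma exclusion_rate_arrival:
  assumes "k \<in> {1..K}" "x 1 = 0"
  shows "0 < exclusion_rate N K \<alpha> \<beta> \<delta> x (x(1 := k))"
proof (rule exclusion_rate_pos_if[OF assms(1)], rule disjI1)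
  show "0 < (\<Sum>i\<in>{1, N}. if x i = 0 \<and> x(1 := k) = x(i := k) then \<alpha> k else 0)"
    by (rule sum_pos2[of _ 1]) (use assms \<alpha>_pos[OF assms(1)] in auto)
qed

lemma exclusion_rate_departure:
  assumes "x 1 \<in> {1..K}"
  shows "0 < exclusion_rate N K \<alpha> \<beta> \<delta> x (x(1 := 0))"
proof (rule exclusion_rate_pos_if[OF assms(1)], rule disjI2, rule disjI1)
  show "0 < (\<Sum>i\<in>{1, N}. if x i = x 1 \<and> x(1 := 0) = x(i := 0) then \<beta> (x 1) else 0)"
    by (rule sum_pos2[of _ 1]) (use assms \<beta>_pos[OF assms] in auto)
qed

lemma exclusion_rate_hop:
  assumes "x i \<in> {1..K}" "x j = 0" "i \<in> {1..N}" "j \<in> {1..N}" "\<bar>int i - int j\<bar> = 1"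
  shows "0 < exclusion_rate N K \<alpha> \<beta> \<delta> x (x(i := 0, j := x i))"
proof (rule exclusion_rate_pos_if[OF assms(1)], rule disjI2, rule disjI2)
  let ?f = "\<lambda>i' j'. if \<bar>int i' - int j'\<bar> = 1 \<and> x i' = x i \<and> x j' = 0 \<and>
    x(i := 0, j := x i) = x(i' := 0, j' := x i) then \<delta> (x i) else 0"
  have nonneg: "0 \<le> ?f i' j'" for i' j' using \<delta>_pos[OF assms(1)] by simp
  have row: "0 < (\<Sum>j'=1..N. ?f i j')"
    by (rule sum_pos2[OF _ assms(4)]) (use assms \<delta>_pos[OF assms(1)] in auto)
  show "0 < (\<Sum>i'=1..N. \<Sum>j'=1..N. ?f i' j')"
    by (rule sum_pos2[where f = "\<lambda>i'. \<Sum>j'=1..N. ?f i' j'", OF finite_atLeastAtMost assms(3) row])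
       (intro sum_nonneg nonneg)
qed

lemma exclusion_states_update:
  "x \<in> exclusion_states N K \<Longrightarrow> i \<in> {1..N} \<Longrightarrow> k \<le> K \<Longrightarrow> x(i := k) \<in> exclusion_states N K"
  by (auto simp: exclusion_states_def PiE_iff extensional_def)

text \<open>All sites to the left are vacant, so the particle can hop left one site at a time and
  depart from site 1. Each hop is undone by the opposite hop, the departure by an arrival of the
  same type.\<close>

lemma remove_leftmost_particle:
  assumes "x \<in> exclusion_states N K" "i \<in> {1..N}" "x i \<noteq> 0" "\<And>j. j \<in> {1..<i} \<Longrightarrow> x j = 0"
  shows "(x, x(i := 0)) \<in> (exclusion_link N K \<alpha> \<beta> \<delta>)\<^sup>*"
  using assms
proof (induction i arbitrary: x)
  case 0
  then show ?case by simp
next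
  case (Suc i)
  define k where "k = x (Suc i)"
  have k: "k \<in> {1..K}" using Suc.prems(1-3)
    by (auto simp: k_def exclusion_states_def PiE_iff Suc_le_eq)
  show ?case
  proof (cases "i = 0")
    case True
    have "0 < exclusion_rate N K \<alpha> \<beta> \<delta> x (x(1 := 0))"
      by (rule exclusion_rate_departure) (use k True in \<open>simp add: k_def\<close>)
    moreover have "0 < exclusion_rate N K \<alpha> \<beta> \<delta> (x(1 := 0)) ((x(1 := 0))(1 := k))"
      by (rule exclusion_rate_arrival) (use k in simp_all)
    moreover have "x(1 := 0) \<noteq> x" using Suc.prems True by (auto simp: fun_eq_iff)
    ultimately have "(x, x(1 := 0)) \<in> exclusion_link N K \<alpha> \<beta> \<delta>"
      using Suc.prems exclusion_states_update[OF Suc.prems(1,2), of 0] True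
      by (simp add: exclusion_link_def k_def)
    then have "(x, x(1 := 0)) \<in> (exclusion_link N K \<alpha> \<beta> \<delta>)\<^sup>*" by (rule r_into_rtrancl)
    then show ?thesis unfolding True One_nat_def .
  next
    case False
    have i: "i \<in> {1..N}" "Suc i \<in> {1..N}" "x i = 0" using False Suc.prems by auto
    \<comment> \<open>The configuration after one hop to the left; its leftmost particle is at site
      \<open>i\<close>, so the induction hypothesis applies.\<close>
    define z where "z = x(Suc i := 0, i := k)"
    have z: "z \<in> exclusion_states N K"
      unfolding z_def using Suc.prems(1) i k by (intro exclusion_states_update) auto
    have "0 < exclusion_rate N K \<alpha> \<beta> \<delta> x z"
      unfolding z_def k_def by (rule exclusion_rate_hop) (use k i in \<open>auto simp: k_def\<close>)
    moreover have "0 < exclusion_rate N K \<alpha> \<beta> \<delta> z (z(i := 0, Suc i := z i))"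
      by (rule exclusion_rate_hop) (use k i in \<open>auto simp: z_def\<close>)
    moreover have "z(i := 0, Suc i := z i) = x" using i by (auto simp: z_def k_def)
    moreover have "z i \<noteq> x i" using i k by (simp add: z_def)
    ultimately have "(x, z) \<in> exclusion_link N K \<alpha> \<beta> \<delta>"
      using Suc.prems(1) z unfolding exclusion_link_def by auto
    also have "(z, z(i := 0)) \<in> (exclusion_link N K \<alpha> \<beta> \<delta>)\<^sup>*"
      by (rule Suc.IH[OF z i(1)]) (use k Suc.prems in \<open>auto simp: z_def\<close>)
    \<comment> \<open>Site \<open>i\<close> was vacant in \<open>x\<close>, so emptying it again
      leaves only the removal at \<open>Suc i\<close>.\<close>
    also have "z(i := 0) = x(Suc i := 0)" using i by (auto simp: z_def)
    finally show ?thesis .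
  qed
qed

text \<open>Induction on the number of particles: removing the leftmost one lowers it by
  one.\<close>

lemma exclusion_link_to_empty:
  assumes "x \<in> exclusion_states N K"
  shows "(x, restrict (\<lambda>_. 0) {1..N}) \<in> (exclusion_link N K \<alpha> \<beta> \<delta>)\<^sup>*"
  using assms
proof (induction "card {i \<in> {1..N}. x i \<noteq> 0}" arbitrary: x rule: less_induct)
  case less
  show ?case
  proof (cases "\<exists>i\<in>{1..N}. x i \<noteq> 0")
    case False
    then have "x = restrict (\<lambda>_. 0) {1..N}"
      using less.prems by (auto simp: exclusion_states_def PiE_iff extensional_def fun_eq_iff)
    then show ?thesis by simp
  next
    case True
    define i where "i = (LEAST i. i \<in> {1..N} \<and> x i \<noteq> 0)"
    have "i \<in> {1..N} \<and> x i \<noteq> 0"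
      unfolding i_def by (rule LeastI_ex) (use True in blast)
    then have i: "i \<in> {1..N}" "x i \<noteq> 0" by auto
    have "x j = 0" if "j \<in> {1..<i}" for j
      using not_less_Least[of j "\<lambda>i. i \<in> {1..N} \<and> x i \<noteq> 0"] that i by (auto simp: i_def)
    then have "(x, x(i := 0)) \<in> (exclusion_link N K \<alpha> \<beta> \<delta>)\<^sup>*"
      by (rule remove_leftmost_particle[OF less.prems i])
    also have "(x(i := 0), restrict (\<lambda>_. 0) {1..N}) \<in> (exclusion_link N K \<alpha> \<beta> \<delta>)\<^sup>*"
    proof (rule less.hyps)
      show "card {j \<in> {1..N}. (x(i := 0)) j \<noteq> 0} < card {j \<in> {1..N}. x j \<noteq> 0}"
        using i by (intro psubset_card_mono) auto
    qed (use exclusion_states_update less.prems i in auto)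
    finally show ?thesis .
  qed
qed

text \<open>Both configurations are linked to the empty one, and the second path is reversed by
  symmetry.\<close>

lemma exclusion_link_connected:
  assumes "x \<in> exclusion_states N K" "z \<in> exclusion_states N K"
  shows "(x, z) \<in> (exclusion_link N K \<alpha> \<beta> \<delta>)\<^sup>*"
proof -
  have "sym ((exclusion_link N K \<alpha> \<beta> \<delta>)\<^sup>*)"
    by (rule sym_rtrancl) (auto simp: sym_def exclusion_link_def)
  then show ?thesis
    using exclusion_link_to_empty[OF assms(1)] exclusion_link_to_empty[OF assms(2)]
    by (meson rtrancl_trans symD)
qed

end

section \<open>Ergodicity of the exclusion process\<close>

theorem theorem1:
  fixes N K :: nat
    and \<alpha> \<beta> \<delta> :: "nat \<Rightarrow> real"
    and M :: "(nat \<Rightarrow> nat) \<Rightarrow> 'a measure"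
    and X :: "real \<Rightarrow> 'a \<Rightarrow> (nat \<Rightarrow> nat)"
  assumes "N \<ge> 2" and "K \<ge> 1"
    and "\<And>k. k \<in> {1..K} \<Longrightarrow> \<alpha> k > 0"
    and "\<And>k. k \<in> {1..K} \<Longrightarrow> \<beta> k > 0"
    and "\<And>k. k \<in> {1..K} \<Longrightarrow> \<delta> k > 0"
    and "finite_ctmc (exclusion_states N K) (exclusion_rate N K \<alpha> \<beta> \<delta>) M X"
  shows "\<exists>p :: (nat \<Rightarrow> nat) \<Rightarrow> real. \<forall>x \<in> exclusion_states N K.
           p x \<noteq> 0 \<and>
           (\<forall>y \<in> exclusion_states N K.
              ((\<lambda>t. \<P>(\<omega> in M y. X t \<omega> = x \<bar> X 0 \<omega> = y)) \<longlongrightarrow> p x) at_top)"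
proof (rule bchoice, rule ballI)
  interpret finite_ctmc "exclusion_states N K" "exclusion_rate N K \<alpha> \<beta> \<delta>" M X
    by (rule assms(6))
  \<comment> \<open>By \<open>bchoice\<close> the limits may be found for one target state at a
    time.\<close>
  fix x assume x: "x \<in> exclusion_states N K"
  have "exclusion_link N K \<alpha> \<beta> \<delta> \<subseteq> rate_graph"
    by (auto simp: exclusion_link_def rate_graph_def)
  then have "(y, z) \<in> rate_graph\<^sup>*"
    if "y \<in> exclusion_states N K" "z \<in> exclusion_states N K" for y z
    using exclusion_link_connected[of K \<alpha> \<beta> \<delta> y N z, OF assms(3-5) that] rtrancl_mono by blast
  then obtain p where p: "0 < p"
    and lim: "\<And>y. y \<in> exclusion_states N K \<Longrightarrow> ((\<lambda>t. transition t y x) \<longlongrightarrow> p) at_top"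
    using irreducible_ergodic[OF _ x] by metis
  have "((\<lambda>t. \<P>(\<omega> in M y. X t \<omega> = x \<bar> X 0 \<omega> = y)) \<longlongrightarrow> p) at_top"
    if y: "y \<in> exclusion_states N K" for y
  \<comment> \<open>The conditional probability is identified with \<open>transition t y x\<close>
    for \<open>t \<ge> 0\<close>, which is enough for a limit at infinity.\<close>
  proof (rule Lim_transform_eventually[OF lim[OF y]])
    show "\<forall>\<^sub>F t in at_top. transition t y x = \<P>(\<omega> in M y. X t \<omega> = x \<bar> X 0 \<omega> = y)"
      using eventually_ge_at_top[of 0] by eventually_elim (simp add: cond_prob_initial[OF y])
  qed
  with p show "\<exists>p. p \<noteq> 0 \<and> (\<forall>y\<in>exclusion_states N K.
      ((\<lambda>t. \<P>(\<omega> in M y. X t \<omega> = x \<bar> X 0 \<omega> = y)) \<longlongrightarrow> p) at_top)"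
    by (metis less_irrefl)
qed

end
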